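(* Let $(X,\mathscr{A},\mu)$ be a probability measure space. Then $\mu$ is bounded away from zero if and only if $U_\mu$ is an open set in $\mathcal{M}_\mu$.
   Context: $\mathcal{M}$ is the ring of real-valued measurable functions on $(X,\mathscr{A},\mu)$, where two functions that are equal $\mu$-almost everywhere are identified. A sequence $\{f_n\}$ in $\mathcal{M}$ converges in measure to $f\in\mathcal{M}$ if for each $c>0$, $\lim_{n\to\infty}\mu(\{x\in X:|f_n(x)-f(x)|>c\})=0$. For $A\subseteq\mathcal{M}$, $\overline{A}$ is the set of all $f\in\mathcal{M}$ for which there is a sequence in $A$ converging to $f$ in measure. $\mathcal{M}_\mu$ denotes $\mathcal{M}$ with the topology of convergence in measure, i.e. the topology $\{\mathcal{M}\setminus A: A\subseteq\mathcal{M},\ A=\overline{A}\}$. $U_\mu$ is the set of all units of the ring $\mathcal{M}$; with $Z(f)=\{x\in X:f(x)=0\}$, $f\in\mathcal{M}$ is a unit if and only if $\mu(Z(f))=0$. The measure $\mu$ is bounded away from zero if there exists $\lambda>0$ such that for every $A\in\mathscr{A}$ either $\mu(A)=0$ or $\mu(A)\ge\lambda$. *)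

theory Defs
  imports "HOL-Probability.Probability" "HOL-Algebra.Ring"
begin

text \<open>Equality almost everywhere, on real-valued measurable functions. Values outside
  \<^term>\<open>space M\<close> do not matter for \<^term>\<open>\<lambda>P. AE x in M. P x\<close>, so the classes below are
  the usual classes of measurable functions on the underlying space.\<close>

definition ae_eq :: "'a measure \<Rightarrow> (('a \<Rightarrow> real) \<times> ('a \<Rightarrow> real)) set" where
  "ae_eq M = {(f, g). f \<in> borel_measurable M \<and> g \<in> borel_measurable M \<and> (AE x in M. f x = g x)}"

definition meas_ring :: "'a measure \<Rightarrow> ('a \<Rightarrow> real) set ring" where
  "meas_ring M =
    \<lparr> carrier = borel_measurable M // ae_eq M,
      mult = (\<lambda>F G. \<Union>f\<in>F. \<Union>g\<in>G. ae_eq M `` {\<lambda>x. f x * g x}),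
      one = ae_eq M `` {\<lambda>x. 1},
      zero = ae_eq M `` {\<lambda>x. 0},
      add = (\<lambda>F G. \<Union>f\<in>F. \<Union>g\<in>G. ae_eq M `` {\<lambda>x. f x + g x}) \<rparr>"

definition fun_converges_in_measure ::
    "'a measure \<Rightarrow> (nat \<Rightarrow> 'a \<Rightarrow> real) \<Rightarrow> ('a \<Rightarrow> real) \<Rightarrow> bool" where
  "fun_converges_in_measure M fs f \<longleftrightarrow>
    (\<forall>c>0. (\<lambda>n. emeasure M {x \<in> space M. \<bar>fs n x - f x\<bar> > c}) \<longlonglongrightarrow> 0)"

text \<open>Convergence in measure of classes, through representatives; by
  \<open>converges_in_measure_class\<close> below the choice of representatives is irrelevant.\<close>

definition converges_in_measure ::
    "'a measure \<Rightarrow> (nat \<Rightarrow> ('a \<Rightarrow> real) set) \<Rightarrow> ('a \<Rightarrow> real) set \<Rightarrow> bool" where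
  "converges_in_measure M Fs F \<longleftrightarrow>
    (\<exists>fs f. (\<forall>n. fs n \<in> Fs n) \<and> f \<in> F \<and> fun_converges_in_measure M fs f)"

definition measure_closure ::
    "'a measure \<Rightarrow> ('a \<Rightarrow> real) set set \<Rightarrow> ('a \<Rightarrow> real) set set" where
  "measure_closure M A =
    {F \<in> carrier (meas_ring M). \<exists>Fs. (\<forall>n. Fs n \<in> A) \<and> converges_in_measure M Fs F}"

text \<open>The predicate below is a topology for every measure: see \<open>openin_measure_topology\<close>.\<close>

definition measure_topology :: "'a measure \<Rightarrow> ('a \<Rightarrow> real) set topology" where
  "measure_topology M = topology (\<lambda>V. \<exists>A. A \<subseteq> carrier (meas_ring M) \<and>
    A = measure_closure M A \<and> V = carrier (meas_ring M) - A)"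

definition bounded_away_from_zero :: "'a measure \<Rightarrow> bool" where
  "bounded_away_from_zero M \<longleftrightarrow>
    (\<exists>l::real. l > 0 \<and> (\<forall>A\<in>sets M. emeasure M A = 0 \<or> emeasure M A \<ge> ennreal l))"

lemma equiv_ae_eq: "equiv (borel_measurable M) (ae_eq M)"
  by (intro equivI) (auto simp: ae_eq_def refl_on_def sym_def trans_def eq_commute)

lemma ae_eq_class_eq_iff:
  assumes "f \<in> borel_measurable M" "g \<in> borel_measurable M"
  shows "ae_eq M `` {f} = ae_eq M `` {g} \<longleftrightarrow> (AE x in M. f x = g x)"
  using eq_equiv_class_iff[OF equiv_ae_eq assms] assms by (simp add: ae_eq_def)

lemma carrier_meas_ring: "carrier (meas_ring M) = borel_measurable M // ae_eq M"
  by (simp add: meas_ring_def)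

lemma class_in_meas_ring:
  "f \<in> borel_measurable M \<Longrightarrow> ae_eq M `` {f} \<in> carrier (meas_ring M)"
  by (simp add: carrier_meas_ring quotientI)

lemma meas_ring_cases:
  assumes "F \<in> carrier (meas_ring M)"
  obtains f where "f \<in> borel_measurable M" "F = ae_eq M `` {f}"
  using assms by (auto simp: carrier_meas_ring elim: quotientE)

lemma mult_meas_ring:
  assumes "f \<in> borel_measurable M" "g \<in> borel_measurable M"
  shows "ae_eq M `` {f} \<otimes>\<^bsub>meas_ring M\<^esub> ae_eq M `` {g} = ae_eq M `` {\<lambda>x. f x * g x}"
proof -
  have "congruent2 (ae_eq M) (ae_eq M) (\<lambda>f g. ae_eq M `` {\<lambda>x. f x * g x})"
    by (rule congruent2I') (subst ae_eq_class_eq_iff; auto simp: ae_eq_def)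
  from UN_equiv_class2[OF equiv_ae_eq equiv_ae_eq this assms] show ?thesis
    by (simp add: meas_ring_def)
qed

lemma add_meas_ring:
  assumes "f \<in> borel_measurable M" "g \<in> borel_measurable M"
  shows "ae_eq M `` {f} \<oplus>\<^bsub>meas_ring M\<^esub> ae_eq M `` {g} = ae_eq M `` {\<lambda>x. f x + g x}"
proof -
  have "congruent2 (ae_eq M) (ae_eq M) (\<lambda>f g. ae_eq M `` {\<lambda>x. f x + g x})"
    by (rule congruent2I') (subst ae_eq_class_eq_iff; auto simp: ae_eq_def)
  from UN_equiv_class2[OF equiv_ae_eq equiv_ae_eq this assms] show ?thesis
    by (simp add: meas_ring_def)
qed

lemma one_meas_ring: "\<one>\<^bsub>meas_ring M\<^esub> = ae_eq M `` {\<lambda>x. 1}"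
  and zero_meas_ring: "\<zero>\<^bsub>meas_ring M\<^esub> = ae_eq M `` {\<lambda>x. 0}"
  by (simp_all add: meas_ring_def)

lemma cring_meas_ring: "cring (meas_ring M)"
proof (rule cringI)
  show "abelian_group (meas_ring M)"
  proof (rule abelian_groupI)
    fix F assume "F \<in> carrier (meas_ring M)"
    then obtain f where f: "f \<in> borel_measurable M" "F = ae_eq M `` {f}"
      by (rule meas_ring_cases)
    then have "ae_eq M `` {\<lambda>x. - f x} \<oplus>\<^bsub>meas_ring M\<^esub> F = \<zero>\<^bsub>meas_ring M\<^esub>"
      by (simp add: add_meas_ring zero_meas_ring)
    then show "\<exists>G\<in>carrier (meas_ring M). G \<oplus>\<^bsub>meas_ring M\<^esub> F = \<zero>\<^bsub>meas_ring M\<^esub>"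
      using class_in_meas_ring[of "\<lambda>x. - f x" M] f by auto
  qed (auto elim!: meas_ring_cases
        simp: add_meas_ring zero_meas_ring class_in_meas_ring add_ac)
  show "comm_monoid (meas_ring M)"
    by (rule comm_monoidI) (auto elim!: meas_ring_cases
        simp: mult_meas_ring one_meas_ring class_in_meas_ring mult_ac)
qed (auto elim!: meas_ring_cases
      simp: mult_meas_ring add_meas_ring class_in_meas_ring distrib_right)

lemma fun_converges_in_measure_cong:
  assumes "\<And>n. (fs n, gs n) \<in> ae_eq M" "(f, g) \<in> ae_eq M"
  shows "fun_converges_in_measure M fs f \<longleftrightarrow> fun_converges_in_measure M gs g"
proof -
  have "emeasure M {x \<in> space M. \<bar>fs n x - f x\<bar> > c} = emeasure M {x \<in> space M. \<bar>gs n x - g x\<bar> > c}"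
    for n c
  proof (rule emeasure_eq_AE)
    have [measurable]: "fs n \<in> borel_measurable M" "gs n \<in> borel_measurable M"
      "f \<in> borel_measurable M" "g \<in> borel_measurable M"
      using assms(1)[of n] assms(2) by (auto simp: ae_eq_def)
    show "{x \<in> space M. \<bar>fs n x - f x\<bar> > c} \<in> sets M" "{x \<in> space M. \<bar>gs n x - g x\<bar> > c} \<in> sets M"
      by measurable
    have "AE x in M. fs n x = gs n x" "AE x in M. f x = g x"
      using assms(1)[of n] assms(2) by (auto simp: ae_eq_def)
    then show "AE x in M. x \<in> {x \<in> space M. \<bar>fs n x - f x\<bar> > c} \<longleftrightarrow>
        x \<in> {x \<in> space M. \<bar>gs n x - g x\<bar> > c}"
      by eventually_elim auto
  qed
  then show ?thesis by (simp add: fun_converges_in_measure_def)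
qed

lemma converges_in_measure_class:
  assumes "\<And>n. fs n \<in> borel_measurable M" "f \<in> borel_measurable M"
  shows "converges_in_measure M (\<lambda>n. ae_eq M `` {fs n}) (ae_eq M `` {f}) \<longleftrightarrow>
    fun_converges_in_measure M fs f"
proof
  assume "converges_in_measure M (\<lambda>n. ae_eq M `` {fs n}) (ae_eq M `` {f})"
  then obtain gs g where "\<And>n. (fs n, gs n) \<in> ae_eq M" "(f, g) \<in> ae_eq M"
    "fun_converges_in_measure M gs g"
    by (auto simp: converges_in_measure_def)
  then show "fun_converges_in_measure M fs f"
    using fun_converges_in_measure_cong by blast
next
  assume "fun_converges_in_measure M fs f"
  moreover have "fs n \<in> ae_eq M `` {fs n}" "f \<in> ae_eq M `` {f}" for n
    using assms by (auto simp: ae_eq_def)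
  ultimately show "converges_in_measure M (\<lambda>n. ae_eq M `` {fs n}) (ae_eq M `` {f})"
    unfolding converges_in_measure_def by blast
qed

lemma converges_in_measure_subseq:
  assumes "converges_in_measure M Fs F" "strict_mono r"
  shows "converges_in_measure M (\<lambda>n. Fs (r n)) F"
proof -
  obtain fs f where *: "\<And>n. fs n \<in> Fs n" "f \<in> F" "fun_converges_in_measure M fs f"
    using assms(1) by (auto simp: converges_in_measure_def)
  have "fun_converges_in_measure M (\<lambda>n. fs (r n)) f"
    using *(3) LIMSEQ_subseq_LIMSEQ[OF _ assms(2)]
    unfolding fun_converges_in_measure_def by (fastforce simp: o_def)
  with * show ?thesis
    unfolding converges_in_measure_def by (intro exI[of _ "\<lambda>n. fs (r n)"] exI[of _ f]) auto
qed

lemma measure_closure_superset: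
  assumes "A \<subseteq> carrier (meas_ring M)"
  shows "A \<subseteq> measure_closure M A"
proof
  fix F assume F: "F \<in> A"
  then obtain f where f: "f \<in> borel_measurable M" "F = ae_eq M `` {f}"
    using assms meas_ring_cases by blast
  have "fun_converges_in_measure M (\<lambda>n. f) f"
    by (simp add: fun_converges_in_measure_def)
  then have "converges_in_measure M (\<lambda>n. F) F"
    using f converges_in_measure_class[of "\<lambda>n. f" M f] by simp
  then show "F \<in> measure_closure M A"
    using F assms by (auto simp: measure_closure_def)
qed

lemma measure_closure_mono: "A \<subseteq> B \<Longrightarrow> measure_closure M A \<subseteq> measure_closure M B"
  unfolding measure_closure_def by blast

lemma measure_closure_Un: "measure_closure M (A \<union> B) = measure_closure M A \<union> measure_closure M B"
proof
  have *: "F \<in> measure_closure M C"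
    if "infinite {n. Fs n \<in> C}" "converges_in_measure M Fs F" "F \<in> carrier (meas_ring M)" for Fs F C
  proof -
    obtain r :: "nat \<Rightarrow> nat" where r: "strict_mono r" "\<And>n. Fs (r n) \<in> C"
      using infinite_enumerate[of "{n. Fs n \<in> C}"] \<open>infinite {n. Fs n \<in> C}\<close> by auto
    then show ?thesis
      using converges_in_measure_subseq[OF that(2) r(1)] that(3)
      unfolding measure_closure_def by (intro CollectI conjI exI[of _ "\<lambda>n. Fs (r n)"]) auto
  qed
  show "measure_closure M (A \<union> B) \<subseteq> measure_closure M A \<union> measure_closure M B"
  proof
    fix F assume "F \<in> measure_closure M (A \<union> B)"
    then obtain Fs where F: "\<And>n. Fs n \<in> A \<union> B" "converges_in_measure M Fs F"
      "F \<in> carrier (meas_ring M)"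
      by (auto simp: measure_closure_def)
    have "{n. Fs n \<in> A} \<union> {n. Fs n \<in> B} = UNIV" using F(1) by auto
    then have "infinite {n. Fs n \<in> A} \<or> infinite {n. Fs n \<in> B}"
      by (metis finite_Un infinite_UNIV_nat)
    then show "F \<in> measure_closure M A \<union> measure_closure M B"
      using * F by blast
  qed
qed (use measure_closure_mono in blast)

lemma openin_measure_topology:
  "openin (measure_topology M) V \<longleftrightarrow> (\<exists>A. A \<subseteq> carrier (meas_ring M) \<and>
    A = measure_closure M A \<and> V = carrier (meas_ring M) - A)"
proof -
  let ?R = "carrier (meas_ring M)"
  define P where "P = (\<lambda>V. \<exists>A. A \<subseteq> ?R \<and> A = measure_closure M A \<and> V = ?R - A)"
  have PD: "V \<subseteq> ?R \<and> measure_closure M (?R - V) = ?R - V" if "P V" for V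
    using that unfolding P_def by (metis Diff_subset double_diff order_refl)
  have PI: "P V" if "V \<subseteq> ?R" "measure_closure M (?R - V) \<subseteq> ?R - V" for V
    unfolding P_def using that measure_closure_superset[of "?R - V" M]
    by (intro exI[of _ "?R - V"]) auto
  have "istopology P"
    unfolding istopology_def
  proof (intro conjI allI impI)
    fix S T assume "P S" "P T"
    then have ST: "S \<subseteq> ?R" "measure_closure M (?R - S) = ?R - S"
      "T \<subseteq> ?R" "measure_closure M (?R - T) = ?R - T"
      using PD by auto
    show "P (S \<inter> T)"
      by (rule PI) (use ST in \<open>auto simp: Diff_Int measure_closure_Un\<close>)
  next
    fix K assume K: "\<forall>S\<in>K. P S"
    show "P (\<Union>K)"
    proof (rule PI)
      show "\<Union>K \<subseteq> ?R" using K PD by blast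
      have "measure_closure M (?R - \<Union>K) \<subseteq> ?R - S" if "S \<in> K" for S
        using PD[of S] K that measure_closure_mono[of "?R - \<Union>K" "?R - S" M] by blast
      moreover have "measure_closure M (?R - \<Union>K) \<subseteq> ?R"
        by (auto simp: measure_closure_def)
      ultimately show "measure_closure M (?R - \<Union>K) \<subseteq> ?R - \<Union>K" by blast
    qed
  qed
  then show ?thesis
    unfolding measure_topology_def P_def by (simp add: topology_inverse')
qed

lemma topspace_measure_topology: "topspace (measure_topology M) = carrier (meas_ring M)"
proof
  have "openin (measure_topology M) (carrier (meas_ring M))"
    unfolding openin_measure_topology by (rule exI[of _ "{}"]) (auto simp: measure_closure_def)
  then show "carrier (meas_ring M) \<subseteq> topspace (measure_topology M)"
    by (rule openin_subset)
  show "topspace (measure_topology M) \<subseteq> carrier (meas_ring M)"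
    using openin_measure_topology[of M "topspace (measure_topology M)"] by auto
qed

end

theory Submission
  imports Defs
begin

text \<open>If sets of positive measure have measure at least \<open>l\<close>, then a unit \<open>f\<close> satisfies
  \<open>\<bar>f\<bar> > c\<close> almost everywhere for some \<open>c > 0\<close>, so every non-unit differs from \<open>f\<close> by more than
  \<open>c\<close> on its zero set, which has measure at least \<open>l\<close>; hence no sequence of non-units converges
  to \<open>f\<close>. Otherwise there are sets \<open>A n\<close> of positive measure tending to \<open>0\<close>, and the non-units
  \<open>1 - indicator (A n)\<close> converge in measure to the unit \<open>1\<close>.\<close>

text \<open>An inverse class gives \<open>f x * g x = 1\<close> almost everywhere, which rules out
  zeros of \<open>f\<close> off a null set. Conversely, the pointwise \<open>inverse (f x)\<close>
  is measurable and represents an inverse class; the convention \<open>inverse 0 = 0\<close> only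
  matters on the null zero set.\<close>

lemma Units_meas_ring_iff:
  assumes [measurable]: "f \<in> borel_measurable M"
  shows "ae_eq M `` {f} \<in> Units (meas_ring M) \<longleftrightarrow> (AE x in M. f x \<noteq> 0)"
proof
  assume "ae_eq M `` {f} \<in> Units (meas_ring M)"
  then obtain G where G: "G \<in> carrier (meas_ring M)"
    "ae_eq M `` {f} \<otimes>\<^bsub>meas_ring M\<^esub> G = \<one>\<^bsub>meas_ring M\<^esub>"
    unfolding Units_def by auto
  then obtain g where [measurable]: "g \<in> borel_measurable M" and g: "G = ae_eq M `` {g}"
    by (elim meas_ring_cases)
  have "ae_eq M `` {\<lambda>x. f x * g x} = ae_eq M `` {\<lambda>x. 1}"
    using G(2) by (simp add: g mult_meas_ring one_meas_ring)
  then have "AE x in M. f x * g x = 1"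
    by (subst (asm) ae_eq_class_eq_iff) auto
  then show "AE x in M. f x \<noteq> 0"
    by eventually_elim auto
next
  assume ae: "AE x in M. f x \<noteq> 0"
  have "AE x in M. f x * inverse (f x) = 1"
    using ae by eventually_elim auto
  then have eq: "ae_eq M `` {\<lambda>x. f x * inverse (f x)} = \<one>\<^bsub>meas_ring M\<^esub>"
    unfolding one_meas_ring by (subst ae_eq_class_eq_iff) auto
  have "ae_eq M `` {f} \<otimes>\<^bsub>meas_ring M\<^esub> ae_eq M `` {\<lambda>x. inverse (f x)} = \<one>\<^bsub>meas_ring M\<^esub>"
    "ae_eq M `` {\<lambda>x. inverse (f x)} \<otimes>\<^bsub>meas_ring M\<^esub> ae_eq M `` {f} = \<one>\<^bsub>meas_ring M\<^esub>"
    using eq by (simp_all add: mult_meas_ring mult.commute)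
  then show "ae_eq M `` {f} \<in> Units (meas_ring M)"
    unfolding Units_def
    using class_in_meas_ring[OF assms] class_in_meas_ring[of "\<lambda>x. inverse (f x)" M] by auto
qed

text \<open>The closed set that witnesses openness of \<open>V\<close> must be its complement. Since
  a set of classes lies in its own closure, closedness of the complement only requires that no
  member of \<open>V\<close> be a limit of classes outside \<open>V\<close>; in this form sequences
  can be used directly.\<close>

lemma openin_measure_topology_iff_closure:
  "openin (measure_topology M) V \<longleftrightarrow> V \<subseteq> carrier (meas_ring M) \<and>
    measure_closure M (carrier (meas_ring M) - V) \<inter> V = {}"
  (is "_ \<longleftrightarrow> V \<subseteq> ?R \<and> _")
proof
  assume "openin (measure_topology M) V"
  then show "V \<subseteq> ?R \<and> measure_closure M (?R - V) \<inter> V = {}"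
    unfolding openin_measure_topology by (metis Diff_disjoint Diff_subset double_diff order_refl)
next
  assume *: "V \<subseteq> ?R \<and> measure_closure M (?R - V) \<inter> V = {}"
  moreover have "measure_closure M (?R - V) \<subseteq> ?R"
    by (auto simp: measure_closure_def)
  ultimately show "openin (measure_topology M) V"
    unfolding openin_measure_topology using measure_closure_superset[of "?R - V" M]
    by (intro exI[of _ "?R - V"]) auto
qed

text \<open>The sets where \<open>f\<close> is at most \<open>1/(k+1)\<close> in absolute value
  decrease to the null zero set, so finiteness of the measure makes their measures tend to 0. Once
  such a measure is below the gap \<open>l\<close>, it must vanish, and \<open>1/(k+1)\<close>
  serves as \<open>c\<close>.\<close>

lemma bounded_away_from_zero_AE_bound:
  fixes f :: "'a \<Rightarrow> real"
  assumes "finite_measure M" "bounded_away_from_zero M"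
    and [measurable]: "f \<in> borel_measurable M" and ae: "AE x in M. f x \<noteq> 0"
  obtains c where "c > 0" "AE x in M. \<bar>f x\<bar> > c"
proof -
  interpret finite_measure M by fact
  obtain l :: real where l: "l > 0" "\<And>A. A \<in> sets M \<Longrightarrow> emeasure M A = 0 \<or> emeasure M A \<ge> ennreal l"
    using assms(2) unfolding bounded_away_from_zero_def by blast
  define B where "B k = {x \<in> space M. \<bar>f x\<bar> \<le> inverse (real (Suc k))}" for k
  have B [measurable]: "B k \<in> sets M" for k
    unfolding B_def by measurable
  have "B (Suc k) \<subseteq> B k" for k
  proof -
    have "inverse (real (Suc (Suc k))) \<le> inverse (real (Suc k))"
      by (intro le_imp_inverse_le) auto
    then show ?thesis unfolding B_def by (auto intro: order_trans)
  qed
  then have "decseq B"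
    by (rule decseq_SucI)
  then have "(\<lambda>k. emeasure M (B k)) \<longlonglongrightarrow> emeasure M (\<Inter>k. B k)"
    by (intro Lim_emeasure_decseq) auto
  moreover have "(\<Inter>k. B k) = {x \<in> space M. f x = 0}"
  proof -
    have "f x = 0" if "\<And>k. \<bar>f x\<bar> \<le> inverse (real (Suc k))" for x
      using that reals_Archimedean[of "\<bar>f x\<bar>"] by (meson not_le zero_less_abs_iff)
    then show ?thesis by (auto simp: B_def)
  qed
  moreover have "emeasure M {x \<in> space M. f x = 0} = 0"
    using ae by (subst (asm) AE_iff_measurable[OF _ refl]) auto
  ultimately have "(\<lambda>k. emeasure M (B k)) \<longlonglongrightarrow> 0"
    by simp
  then have "eventually (\<lambda>k. emeasure M (B k) < ennreal l) sequentially"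
    by (rule order_tendstoD) (simp add: l)
  then obtain k where "emeasure M (B k) < ennreal l"
    by (auto simp: eventually_sequentially)
  then have "emeasure M (B k) = 0"
    using l(2)[OF B] leD by blast
  then have "AE x in M. \<not> \<bar>f x\<bar> \<le> inverse (real (Suc k))"
    by (subst AE_iff_measurable[OF B]) (auto simp: B_def)
  then have "AE x in M. \<bar>f x\<bar> > inverse (real (Suc k))"
    by (simp add: not_le)
  then show ?thesis
    by (rule that[rotated]) auto
qed

theorem theorem2p21:
  fixes M :: "'a measure"
  assumes "prob_space M"
  shows "bounded_away_from_zero M \<longleftrightarrow> openin (measure_topology M) (Units (meas_ring M))"
proof
  let ?R = "carrier (meas_ring M)" and ?U = "Units (meas_ring M)"
  interpret prob_space M by fact
  {
    assume bdd: "bounded_away_from_zero M"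
    then obtain l :: real where l: "l > 0"
      "\<And>A. A \<in> sets M \<Longrightarrow> emeasure M A = 0 \<or> emeasure M A \<ge> ennreal l"
      unfolding bounded_away_from_zero_def by blast
    have False if F: "F \<in> measure_closure M (?R - ?U)" "F \<in> ?U" for F
    proof -
      obtain Fs where Fs: "\<And>n. Fs n \<in> ?R - ?U" "converges_in_measure M Fs F"
        using F(1) unfolding measure_closure_def by auto
      have "\<exists>h. h \<in> borel_measurable M \<and> Fs n = ae_eq M `` {h}" for n
        using Fs(1)[of n] by (auto elim!: meas_ring_cases)
      then obtain fs where [measurable]: "\<And>n. fs n \<in> borel_measurable M"
        and fs: "\<And>n. Fs n = ae_eq M `` {fs n}"
        by metis
      have "F \<in> ?R"
        using F(2) by (simp add: Units_def)
      then obtain f where [measurable]: "f \<in> borel_measurable M" and f: "F = ae_eq M `` {f}"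
        by (rule meas_ring_cases)
      \<comment> \<open>\<open>converges_in_measure_class\<close> speaks of a sequence written as
        classes of representatives, so \<open>Fs\<close> is put into this form as a
        function.\<close>
      have "Fs = (\<lambda>n. ae_eq M `` {fs n})"
        using fs by auto
      then have conv: "fun_converges_in_measure M fs f"
        using Fs(2) f converges_in_measure_class[of fs M f] by simp
      have "AE x in M. f x \<noteq> 0"
        using F(2) by (simp add: f Units_meas_ring_iff)
      then obtain c where c: "c > 0" "AE x in M. \<bar>f x\<bar> > c"
        using bounded_away_from_zero_AE_bound[OF finite_measure_axioms bdd \<open>f \<in> borel_measurable M\<close>]
        by blast
      \<comment> \<open>Where \<open>fs n\<close> vanishes, the deviation equals the absolute value
        of \<open>f x\<close>, hence exceeds \<open>c\<close> almost everywhere. This zero set is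
        not null because \<open>fs n\<close> represents a non-unit, so the gap applies to
        it.\<close>
      have "ennreal l \<le> emeasure M {x \<in> space M. \<bar>fs n x - f x\<bar> > c}" for n
      proof -
        have "\<not> (AE x in M. fs n x \<noteq> 0)"
          using Fs(1)[of n] by (simp add: fs Units_meas_ring_iff)
        then have "emeasure M {x \<in> space M. fs n x = 0} \<noteq> 0"
          by (subst (asm) AE_iff_measurable[OF _ refl]) auto
        moreover have "{x \<in> space M. fs n x = 0} \<in> sets M"
          by measurable
        ultimately have "ennreal l \<le> emeasure M {x \<in> space M. fs n x = 0}"
          using l(2) by blast
        also have "\<dots> \<le> emeasure M {x \<in> space M. \<bar>fs n x - f x\<bar> > c}"
        proof (rule emeasure_mono_AE)
          show "AE x in M. x \<in> {x \<in> space M. fs n x = 0} \<longrightarrow>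
              x \<in> {x \<in> space M. \<bar>fs n x - f x\<bar> > c}"
            using c(2) by eventually_elim auto
        qed measurable
        finally show ?thesis .
      qed
      moreover have "(\<lambda>n. emeasure M {x \<in> space M. \<bar>fs n x - f x\<bar> > c}) \<longlonglongrightarrow> 0"
        using conv c(1) by (auto simp: fun_converges_in_measure_def)
      ultimately have "ennreal l \<le> 0"
        by (intro LIMSEQ_le_const) auto
      then show False
        using l(1) by simp
    qed
    then show "openin (measure_topology M) ?U"
      unfolding openin_measure_topology_iff_closure by (auto simp: Units_def)
  }
  {
    assume op: "openin (measure_topology M) ?U"
    show "bounded_away_from_zero M"
    proof (rule ccontr)
      assume "\<not> bounded_away_from_zero M"
      \<comment> \<open>Each \<open>1/(n+1)\<close> is positive and so fails as a lower bound
        \<open>l\<close>.\<close>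
      then have "\<exists>A\<in>sets M. emeasure M A \<noteq> 0 \<and> emeasure M A < ennreal (inverse (real (Suc n)))"
        for n
        unfolding bounded_away_from_zero_def
        by (metis inverse_positive_iff_positive not_le of_nat_0_less_iff zero_less_Suc)
      then obtain A where [measurable]: "\<And>n. A n \<in> sets M"
        and A: "\<And>n. emeasure M (A n) \<noteq> 0"
          "\<And>n. emeasure M (A n) < ennreal (inverse (real (Suc n)))"
        by metis
      have lim: "(\<lambda>n. emeasure M (A n)) \<longlonglongrightarrow> 0"
      proof (rule tendsto_sandwich[OF _ _ tendsto_const])
        show "(\<lambda>n. ennreal (inverse (real (Suc n)))) \<longlonglongrightarrow> 0"
          using tendsto_ennrealI[OF LIMSEQ_inverse_real_of_nat] by simp
        show "eventually (\<lambda>n. emeasure M (A n) \<le> ennreal (inverse (real (Suc n)))) sequentially"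
          using A(2) by (intro always_eventually allI less_imp_le)
      qed auto
      \<comment> \<open>This function vanishes exactly on \<open>A n\<close>, which makes it a
        non-unit, and equals 1 elsewhere.\<close>
      define fs where "fs n x = 1 - (indicator (A n) x :: real)" for n x
      have [measurable]: "fs n \<in> borel_measurable M" for n
        unfolding fs_def by measurable
      have "fun_converges_in_measure M fs (\<lambda>x. 1)"
        unfolding fun_converges_in_measure_def
      proof (intro allI impI)
        fix c :: real assume c: "c > 0"
        \<comment> \<open>Off \<open>A n\<close> the deviation is 0, so it can exceed
          \<open>c\<close> only inside \<open>A n\<close>.\<close>
        have le: "emeasure M {x \<in> space M. \<bar>fs n x - 1\<bar> > c} \<le> emeasure M (A n)" for n
          using c by (intro emeasure_mono) (auto simp: fs_def indicator_def split: if_splits)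
        show "(\<lambda>n. emeasure M {x \<in> space M. \<bar>fs n x - 1\<bar> > c}) \<longlonglongrightarrow> 0"
          by (rule tendsto_sandwich[OF _ _ tendsto_const lim]) (use le in auto)
      qed
      then have "converges_in_measure M (\<lambda>n. ae_eq M `` {fs n}) (ae_eq M `` {\<lambda>x. 1})"
        by (subst converges_in_measure_class) auto
      moreover have "ae_eq M `` {fs n} \<in> ?R - ?U" for n
      proof -
        have "\<not> (AE x in M. x \<notin> A n)"
          using A(1)[of n] sets.sets_into_space[of "A n" M]
          by (subst AE_iff_measurable[of "A n"]) auto
        moreover have "fs n x \<noteq> 0 \<longleftrightarrow> x \<notin> A n" for x
          by (simp add: fs_def indicator_def)
        ultimately show ?thesis
          by (simp add: Units_meas_ring_iff class_in_meas_ring)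
      qed
      ultimately have "ae_eq M `` {\<lambda>x. 1} \<in> measure_closure M (?R - ?U)"
        unfolding measure_closure_def
        by (intro CollectI conjI exI[of _ "\<lambda>n. ae_eq M `` {fs n}"] class_in_meas_ring) auto
      moreover have "ae_eq M `` {\<lambda>x. 1} \<in> ?U"
        by (simp add: Units_meas_ring_iff)
      ultimately show False
        using op unfolding openin_measure_topology_iff_closure by blast
    qed
  }
qed

end
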